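(* Let $H$ be a monoid and $M$ a submonoid of $H$ with $M^\times = M \cap H^\times$. The following hold: (i) Suppose that $H$ is unit-cancellative and satisfies the ACCP. Then $H$ is atomic. (ii) If $H$ is unit-cancellative, then so is $M$. (iii) Assume that $H$ has a length function. Then $H$ is unit-cancellative and satisfies the ACCP. (iv) If $H$ has a length function $\lambda$, then $M$ is a BF-monoid and $\sup \mathsf L_M(x) \le \lambda(x)$ for all $x \in M$.
   Context: Monoids are written multiplicatively and need not be commutative or cancellative; $H^\times$ is the set of units of $H$; $\mathbf N$ (resp. $\mathbf N^+$) is the set of non-negative (resp. positive) integers; $\sup\emptyset := 0$. $H$ is unit-cancellative if, for $x,y\in H$, $xy = x$ or $yx = x$ implies $y \in H^\times$. $H$ satisfies the ACCP if it satisfies the ascending chain condition on principal right ideals (for every sequence $(a_n)_{n\ge1}$ in $H$ with $a_nH \subseteq a_{n+1}H$ for all $n$, there is $v\in\mathbf N^+$ with $a_nH = a_vH$ for all $n\ge v$) and the analogous condition on principal left ideals $Ha_n$. A length function on $H$ is a function $\lambda: H\to\mathbf N$ such that $\lambda(x)<\lambda(y)$ for all $x,y\in H$ such that $y = uxv$ for some $u,v\in H$ with $u\notin H^\times$ or $v\notin H^\times$. An element $a \in H$ is an atom if $a \notin H^\times$ and there are no $x,y \in H\setminus H^\times$ with $a = xy$; $\mathscr A(H)$ is the set of atoms. $\mathsf L_H(1_H) := \{0\}$, and for $x \ne 1_H$, $\mathsf L_H(x) := \{k \in \mathbf N^+ : x = a_1\cdots a_k \text{ for some } a_1,\dots,a_k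 \in \mathscr A(H)\}$. $H$ is atomic (resp. a BF-monoid) if $\mathsf L_H(x)$ is non-empty (resp. non-empty and finite) for every $x \in H\setminus H^\times$. *)

theory Defs
  imports "HOL-Algebra.Coset" "HOL-Library.Extended_Nat"
begin

definition unit_cancellative :: "('a, 'b) monoid_scheme \<Rightarrow> bool" where
  "unit_cancellative H \<longleftrightarrow>
     (\<forall>x\<in>carrier H. \<forall>y\<in>carrier H.
        x \<otimes>\<^bsub>H\<^esub> y = x \<or> y \<otimes>\<^bsub>H\<^esub> x = x \<longrightarrow> y \<in> Units H)"

text \<open>
  The principal right ideal \<open>aH\<close> is the left coset \<open>a <#\<^bsub>H\<^esub> carrier H\<close>, and the
  principal left ideal \<open>Ha\<close> is the right coset \<open>carrier H #>\<^bsub>H\<^esub> a\<close>.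
\<close>

definition accp_right :: "('a, 'b) monoid_scheme \<Rightarrow> bool" where
  "accp_right H \<longleftrightarrow>
     (\<forall>a :: nat \<Rightarrow> 'a.
        (\<forall>n. a n \<in> carrier H) \<and>
        (\<forall>n. a n <#\<^bsub>H\<^esub> carrier H \<subseteq> a (Suc n) <#\<^bsub>H\<^esub> carrier H) \<longrightarrow>
        (\<exists>v. \<forall>n\<ge>v. a n <#\<^bsub>H\<^esub> carrier H = a v <#\<^bsub>H\<^esub> carrier H))"

definition accp_left :: "('a, 'b) monoid_scheme \<Rightarrow> bool" where
  "accp_left H \<longleftrightarrow>
     (\<forall>a :: nat \<Rightarrow> 'a.
        (\<forall>n. a n \<in> carrier H) \<and>
        (\<forall>n. carrier H #>\<^bsub>H\<^esub> a n \<subseteq> carrier H #>\<^bsub>H\<^esub> a (Suc n)) \<longrightarrow>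
        (\<exists>v. \<forall>n\<ge>v. carrier H #>\<^bsub>H\<^esub> a n = carrier H #>\<^bsub>H\<^esub> a v))"

definition accp :: "('a, 'b) monoid_scheme \<Rightarrow> bool" where
  "accp H \<longleftrightarrow> accp_right H \<and> accp_left H"

definition length_function :: "('a, 'b) monoid_scheme \<Rightarrow> ('a \<Rightarrow> nat) \<Rightarrow> bool" where
  "length_function H l \<longleftrightarrow>
     (\<forall>x\<in>carrier H. \<forall>y\<in>carrier H.
        (\<exists>u\<in>carrier H. \<exists>v\<in>carrier H.
           y = u \<otimes>\<^bsub>H\<^esub> x \<otimes>\<^bsub>H\<^esub> v \<and> (u \<notin> Units H \<or> v \<notin> Units H)) \<longrightarrow>
        l x < l y)"

definition atoms :: "('a, 'b) monoid_scheme \<Rightarrow> 'a set" where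
  "atoms H = {a \<in> carrier H. a \<notin> Units H \<and>
     \<not> (\<exists>x \<in> carrier H - Units H. \<exists>y \<in> carrier H - Units H. a = x \<otimes>\<^bsub>H\<^esub> y)}"

definition length_set :: "('a, 'b) monoid_scheme \<Rightarrow> 'a \<Rightarrow> nat set" where
  "length_set H x =
     (if x = \<one>\<^bsub>H\<^esub> then {0}
      else {k. 0 < k \<and>
             (\<exists>as. length as = k \<and> set as \<subseteq> atoms H \<and> x = foldr (\<otimes>\<^bsub>H\<^esub>) as \<one>\<^bsub>H\<^esub>)})"

definition atomic :: "('a, 'b) monoid_scheme \<Rightarrow> bool" where
  "atomic H \<longleftrightarrow> (\<forall>x \<in> carrier H - Units H. length_set H x \<noteq> {})"

definition BF_monoid :: "('a, 'b) monoid_scheme \<Rightarrow> bool" where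
  "BF_monoid H \<longleftrightarrow>
     (\<forall>x \<in> carrier H - Units H. length_set H x \<noteq> {} \<and> finite (length_set H x))"

end

theory Submission imports Defs begin

text \<open>
  If \<open>x = yz\<close> with \<open>z\<close> not a unit, then unit-cancellativity makes \<open>xH \<subset> yH\<close> strict, and
  symmetrically for left ideals. Choosing one factor after the other in a factorization could
  alternate between the two kinds of ideals, so the two chain conditions are used separately:
  the one on right ideals splits off an atom on the left of every non-unit that is not an atom,
  and the one on left ideals shows that splitting off atoms on the left terminates.
  A length function restricts to \<open>M\<close> and increases with each atom of a product.
\<close>

section \<open>Principal one-sided ideals as well-founded relations\<close>

lemma mem_principal_right_ideal:
  "x \<in> a <#\<^bsub>H\<^esub> carrier H \<longleftrightarrow> (\<exists>h\<in>carrier H. x = a \<otimes>\<^bsub>H\<^esub> h)"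
  by (auto simp: l_coset_def)

lemma mem_principal_left_ideal:
  "x \<in> carrier H #>\<^bsub>H\<^esub> a \<longleftrightarrow> (\<exists>h\<in>carrier H. x = h \<otimes>\<^bsub>H\<^esub> a)"
  by (auto simp: r_coset_def)

text \<open>A descending chain of this relation is a strictly ascending chain of principal right
  ideals. The larger ideal is the smaller element, so induction may assume a claim for every
  \<open>y\<close> whose ideal strictly contains that of \<open>x\<close>.\<close>

lemma wf_principal_right_ideals:
  assumes "accp_right H"
  shows "wf {(y, x). x \<in> carrier H \<and> y \<in> carrier H \<and>
    x <#\<^bsub>H\<^esub> carrier H \<subset> y <#\<^bsub>H\<^esub> carrier H}"
  unfolding wf_iff_no_infinite_down_chain
proof clarify
  fix a :: "nat \<Rightarrow> 'a"
  assume "\<forall>i. (a (Suc i), a i) \<in> {(y, x). x \<in> carrier H \<and> y \<in> carrier H \<and>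
    x <#\<^bsub>H\<^esub> carrier H \<subset> y <#\<^bsub>H\<^esub> carrier H}"
  then have chain: "a n \<in> carrier H" "a n <#\<^bsub>H\<^esub> carrier H \<subset> a (Suc n) <#\<^bsub>H\<^esub> carrier H" for n
    by auto
  then have "\<exists>v. \<forall>n\<ge>v. a n <#\<^bsub>H\<^esub> carrier H = a v <#\<^bsub>H\<^esub> carrier H"
    using assms unfolding accp_right_def by (meson psubset_imp_subset)
  then obtain v where "a (Suc v) <#\<^bsub>H\<^esub> carrier H = a v <#\<^bsub>H\<^esub> carrier H"
    by (meson le_SucI order_refl)
  with chain(2)[of v] show False by simp
qed

lemma wf_principal_left_ideals:
  assumes "accp_left H"
  shows "wf {(y, x). x \<in> carrier H \<and> y \<in> carrier H \<and>
    carrier H #>\<^bsub>H\<^esub> x \<subset> carrier H #>\<^bsub>H\<^esub> y}"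
  unfolding wf_iff_no_infinite_down_chain
proof clarify
  fix a :: "nat \<Rightarrow> 'a"
  assume "\<forall>i. (a (Suc i), a i) \<in> {(y, x). x \<in> carrier H \<and> y \<in> carrier H \<and>
    carrier H #>\<^bsub>H\<^esub> x \<subset> carrier H #>\<^bsub>H\<^esub> y}"
  then have chain: "a n \<in> carrier H" "carrier H #>\<^bsub>H\<^esub> a n \<subset> carrier H #>\<^bsub>H\<^esub> a (Suc n)" for n
    by auto
  then have "\<exists>v. \<forall>n\<ge>v. carrier H #>\<^bsub>H\<^esub> a n = carrier H #>\<^bsub>H\<^esub> a v"
    using assms unfolding accp_left_def by (meson psubset_imp_subset)
  then obtain v where "carrier H #>\<^bsub>H\<^esub> a (Suc v) = carrier H #>\<^bsub>H\<^esub> a v"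
    by (meson le_SucI order_refl)
  with chain(2)[of v] show False by simp
qed

section \<open>Passage to submonoids\<close>

lemma length_function_less:
  assumes "length_function H l" "x \<in> carrier H" "u \<in> carrier H" "v \<in> carrier H"
    "u \<otimes>\<^bsub>H\<^esub> x \<otimes>\<^bsub>H\<^esub> v \<in> carrier H" "u \<notin> Units H \<or> v \<notin> Units H"
  shows "l x < l (u \<otimes>\<^bsub>H\<^esub> x \<otimes>\<^bsub>H\<^esub> v)"
  using assms unfolding length_function_def by blast

text \<open>By the condition on units, a non-unit of \<open>M\<close> is a non-unit of
  \<open>H\<close>, so each inequality demanded in \<open>M\<close> is already demanded in
  \<open>H\<close>.\<close>

lemma length_function_submonoid:
  assumes "length_function H l" "submonoid M H" "Units (H\<lparr>carrier := M\<rparr>) = M \<inter> Units H"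
  shows "length_function (H\<lparr>carrier := M\<rparr>) l"
  using assms(1) submonoid.subset[OF assms(2)] assms(3)
  unfolding length_function_def by (simp add: subset_iff) blast

text \<open>Here the other direction of the condition on units counts: an element of
  \<open>M\<close> that is invertible in \<open>H\<close> has its inverse in
  \<open>M\<close>.\<close>

lemma unit_cancellative_submonoid:
  assumes "unit_cancellative H" "submonoid M H" "Units (H\<lparr>carrier := M\<rparr>) = M \<inter> Units H"
  shows "unit_cancellative (H\<lparr>carrier := M\<rparr>)"
  using assms(1) submonoid.subset[OF assms(2)] assms(3)
  unfolding unit_cancellative_def by auto

section \<open>Divisors and ideals in unit-cancellative monoids\<close>

context monoid
begin

text \<open>If \<open>ab = 1\<close>, then \<open>a(ba) = a\<close> makes \<open>ba\<close> a unit;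
  it is also idempotent, hence equal to 1. The general case reduces to this one.\<close>

lemma unit_factors:
  assumes uc: "unit_cancellative G" and x: "x \<in> carrier G" and y: "y \<in> carrier G"
    and xy: "x \<otimes> y \<in> Units G"
  shows "x \<in> Units G" "y \<in> Units G"
proof -
  have one_sided: "a \<in> Units G \<and> b \<in> Units G"
    if a: "a \<in> carrier G" and b: "b \<in> carrier G" and ab: "a \<otimes> b = \<one>" for a b
  proof -
    have "a \<otimes> (b \<otimes> a) = a" using a b ab by (simp flip: m_assoc)
    then have ba: "b \<otimes> a \<in> Units G" using uc a b unfolding unit_cancellative_def by blast
    have idem: "(b \<otimes> a) \<otimes> (b \<otimes> a) = (b \<otimes> a) \<otimes> \<one>"
      using a b \<open>a \<otimes> (b \<otimes> a) = a\<close> by (simp add: m_assoc)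
    have "b \<otimes> a = \<one>" using Units_l_cancel[OF ba, of "b \<otimes> a" \<one>] idem a b by simp
    with a b ab show ?thesis unfolding Units_def by auto
  qed
  \<comment> \<open>With this \<open>w\<close>, \<open>yw\<close> is a right inverse of
    \<open>x\<close> and \<open>wx\<close> a left inverse of \<open>y\<close>; the one-sided case
    upgrades both.\<close>
  define w where "w = inv (x \<otimes> y)"
  have w: "w \<in> carrier G" using xy by (simp add: w_def)
  have "x \<otimes> (y \<otimes> w) = \<one>" using x y w xy Units_r_inv[OF xy] by (simp add: w_def flip: m_assoc)
  with one_sided x y w show "x \<in> Units G" by blast
  have "(w \<otimes> x) \<otimes> y = \<one>" using x y w xy Units_l_inv[OF xy] by (simp add: w_def m_assoc)
  with one_sided x y w show "y \<in> Units G" by blast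
qed

text \<open>Equal ideals would give \<open>y = yzw\<close>, so \<open>zw\<close> would be a unit,
  and with it its factor \<open>z\<close>.\<close>

lemma principal_right_ideal_psubset:
  assumes uc: "unit_cancellative G" and y: "y \<in> carrier G" and z: "z \<in> carrier G - Units G"
  shows "(y \<otimes> z) <# carrier G \<subset> y <# carrier G"
proof
  show "(y \<otimes> z) <# carrier G \<subseteq> y <# carrier G"
    using y z by (auto simp: mem_principal_right_ideal m_assoc) (metis m_closed)
  show "(y \<otimes> z) <# carrier G \<noteq> y <# carrier G"
  proof
    assume "(y \<otimes> z) <# carrier G = y <# carrier G"
    moreover have "y \<in> y <# carrier G"
      using y by (auto simp: mem_principal_right_ideal intro!: bexI[of _ \<one>])
    ultimately obtain w where w: "w \<in> carrier G" "y = y \<otimes> z \<otimes> w"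
      by (metis mem_principal_right_ideal)
    then have "y \<otimes> (z \<otimes> w) = y" using y z by (simp add: m_assoc)
    then have "z \<otimes> w \<in> Units G" using uc y z w(1) unfolding unit_cancellative_def by blast
    then show False using unit_factors(1)[OF uc] z w(1) by blast
  qed
qed

lemma principal_left_ideal_psubset:
  assumes uc: "unit_cancellative G" and y: "y \<in> carrier G" and z: "z \<in> carrier G - Units G"
  shows "carrier G #> (z \<otimes> y) \<subset> carrier G #> y"
proof
  show "carrier G #> (z \<otimes> y) \<subseteq> carrier G #> y"
    using y z by (auto simp: mem_principal_left_ideal simp flip: m_assoc) (metis m_closed)
  show "carrier G #> (z \<otimes> y) \<noteq> carrier G #> y"
  proof
    assume "carrier G #> (z \<otimes> y) = carrier G #> y"
    moreover have "y \<in> carrier G #> y"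
      using y by (auto simp: mem_principal_left_ideal intro!: bexI[of _ \<one>])
    ultimately obtain w where w: "w \<in> carrier G" "y = w \<otimes> (z \<otimes> y)"
      by (metis mem_principal_left_ideal)
    then have "(w \<otimes> z) \<otimes> y = y" using y z by (simp add: m_assoc)
    then have "w \<otimes> z \<in> Units G" using uc y z w(1) unfolding unit_cancellative_def by blast
    then show False using unit_factors(2)[OF uc] z w(1) by blast
  qed
qed

section \<open>Factorizations into atoms\<close>

lemma split_off_atom:
  assumes uc: "unit_cancellative G" and "accp_right G" and "x \<in> carrier G - Units G"
  shows "x \<in> atoms G \<or> (\<exists>a\<in>atoms G. \<exists>y\<in>carrier G - Units G. x = a \<otimes> y)"
  using wf_principal_right_ideals[OF assms(2)] assms(3)
proof (induction x rule: wf_induct_rule)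
  case (less x)
  show ?case
  proof (cases "x \<in> atoms G")
    case False
    then obtain y z where yz: "y \<in> carrier G - Units G" "z \<in> carrier G - Units G" "x = y \<otimes> z"
      using less.prems unfolding atoms_def by blast
    \<comment> \<open>The induction continues with the left factor \<open>y\<close>: an atom that
      divides \<open>y\<close> on the left also divides \<open>x\<close> on the left.\<close>
    then have "x <# carrier G \<subset> y <# carrier G"
      using principal_right_ideal_psubset[OF uc] by simp
    then consider "y \<in> atoms G"
      | a y' where "a \<in> atoms G" "y' \<in> carrier G - Units G" "y = a \<otimes> y'"
      using less.IH[of y] less.prems yz(1) by blast
    then show ?thesis
    proof cases
      case 1
      with yz show ?thesis by blast
    next
      case 2
      then have "x = a \<otimes> (y' \<otimes> z)" using yz by (simp add: atoms_def m_assoc)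
      moreover have "y' \<otimes> z \<in> carrier G - Units G"
        using unit_factors[OF uc, of y' z] 2 yz by auto
      ultimately show ?thesis using 2 by blast
    qed
  qed simp
qed

text \<open>Once an atom \<open>a\<close> is split off as \<open>x = ay\<close>, the left ideal of
  the cofactor \<open>y\<close> strictly contains that of \<open>x\<close>, since \<open>a\<close>
  is not a unit. Induction on left ideals then factors \<open>y\<close>.\<close>

lemma atom_factorization:
  assumes uc: "unit_cancellative G" and "accp G" and "x \<in> carrier G - Units G"
  shows "\<exists>as. set as \<subseteq> atoms G \<and> x = foldr (\<otimes>) as \<one>"
proof -
  have right: "accp_right G" and left: "accp_left G"
    using assms(2) by (simp_all add: accp_def)
  show ?thesis
    using wf_principal_left_ideals[OF left] assms(3)
  proof (induction x rule: wf_induct_rule)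
    case (less x)
    from split_off_atom[OF uc right less.prems] show ?case
    proof (elim disjE bexE)
      assume "x \<in> atoms G"
      then have "set [x] \<subseteq> atoms G \<and> x = foldr (\<otimes>) [x] \<one>" by (simp add: atoms_def)
      then show ?thesis by blast
    next
      fix a y assume a: "a \<in> atoms G" and y: "y \<in> carrier G - Units G" and x: "x = a \<otimes> y"
      have "carrier G #> x \<subset> carrier G #> y"
        unfolding x using principal_left_ideal_psubset[OF uc] a y by (auto simp: atoms_def)
      then obtain as where "set as \<subseteq> atoms G" "y = foldr (\<otimes>) as \<one>"
        using less.IH[of y] less.prems y by blast
      then have "set (a # as) \<subseteq> atoms G \<and> x = foldr (\<otimes>) (a # as) \<one>" using a x by simp
      then show ?thesis by blast
    qed
  qed
qed

lemma accp_imp_atomic: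
  assumes "unit_cancellative G" "accp G"
  shows "atomic G"
  unfolding atomic_def
proof
  fix x assume x: "x \<in> carrier G - Units G"
  then obtain as where as: "set as \<subseteq> atoms G" "x = foldr (\<otimes>) as \<one>"
    using atom_factorization assms by blast
  \<comment> \<open>This rules out both the special value of \<open>length_set\<close> at the
    identity and the empty list of atoms.\<close>
  have "x \<noteq> \<one>" using x by auto
  with as have "0 < length as" by auto
  with as \<open>x \<noteq> \<one>\<close> have "length as \<in> length_set G x" unfolding length_set_def by auto
  then show "length_set G x \<noteq> {}" by blast
qed

section \<open>Consequences of a length function\<close>

lemma length_function_less_right:
  assumes "length_function G l" "x \<in> carrier G" "h \<in> carrier G - Units G"
  shows "l x < l (x \<otimes> h)"
  using length_function_less[OF assms(1,2), of \<one> h] assms by simp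

lemma length_function_less_left:
  assumes "length_function G l" "x \<in> carrier G" "h \<in> carrier G - Units G"
  shows "l x < l (h \<otimes> x)"
  using length_function_less[OF assms(1,2), of h \<one>] assms by simp

text \<open>A non-unit \<open>y\<close> with \<open>xy = x\<close> or \<open>yx = x\<close> would
  force \<open>l x < l x\<close>.\<close>

lemma length_function_imp_unit_cancellative:
  assumes "length_function G l"
  shows "unit_cancellative G"
  unfolding unit_cancellative_def
  using length_function_less_left[OF assms] length_function_less_right[OF assms]
  by (metis DiffI less_irrefl)

text \<open>
  A length function need not be constant on associates, so the values \<open>l (a n)\<close> need not
  decrease along the chain. They do drop, however, between any two distinct ideals of the
  chain, so the chain is constant from an index with minimal \<open>l (a n)\<close> on.
\<close>

lemma length_function_imp_accp_right:
  assumes l: "length_function G l"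
  shows "accp_right G"
  unfolding accp_right_def
proof clarify
  fix a :: "nat \<Rightarrow> 'a"
  assume a: "\<forall>n. a n \<in> carrier G"
    and chain: "\<forall>n. a n <# carrier G \<subseteq> a (Suc n) <# carrier G"
  obtain v where v: "\<And>n. l (a v) \<le> l (a n)"
    using ex_has_least_nat[of "\<lambda>_. True" _ "\<lambda>n. l (a n)"] by auto
  have "a n <# carrier G = a v <# carrier G" if "v \<le> n" for n
  proof
    show le: "a v <# carrier G \<subseteq> a n <# carrier G"
      using lift_Suc_mono_le[of "\<lambda>n. a n <# carrier G"] chain that by blast
    have "a v \<in> a v <# carrier G"
      using a by (auto simp: mem_principal_right_ideal intro!: bexI[of _ \<one>])
    then obtain h where h: "h \<in> carrier G" "a v = a n \<otimes> h"
      using subsetD[OF le] unfolding mem_principal_right_ideal by blast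
    \<comment> \<open>A non-unit \<open>h\<close> would put \<open>l (a n)\<close> below the minimum
      \<open>l (a v)\<close>. A unit \<open>h\<close> can be moved to the other side, which yields
      the reverse inclusion.\<close>
    then have "h \<in> Units G"
      using length_function_less_right[OF l, of "a n" h] v[of n] a by fastforce
    then have "a n = a v \<otimes> inv h" using h a by (simp add: m_assoc)
    then show "a n <# carrier G \<subseteq> a v <# carrier G"
      using a \<open>h \<in> Units G\<close> by (auto simp: mem_principal_right_ideal)
        (metis Units_inv_closed m_assoc m_closed)
  qed
  then show "\<exists>v. \<forall>n\<ge>v. a n <# carrier G = a v <# carrier G" by blast
qed

lemma length_function_imp_accp_left:
  assumes l: "length_function G l"
  shows "accp_left G"
  unfolding accp_left_def
proof clarify
  fix a :: "nat \<Rightarrow> 'a"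
  assume a: "\<forall>n. a n \<in> carrier G"
    and chain: "\<forall>n. carrier G #> a n \<subseteq> carrier G #> a (Suc n)"
  obtain v where v: "\<And>n. l (a v) \<le> l (a n)"
    using ex_has_least_nat[of "\<lambda>_. True" _ "\<lambda>n. l (a n)"] by auto
  have "carrier G #> a n = carrier G #> a v" if "v \<le> n" for n
  proof
    show le: "carrier G #> a v \<subseteq> carrier G #> a n"
      using lift_Suc_mono_le[of "\<lambda>n. carrier G #> a n"] chain that by blast
    have "a v \<in> carrier G #> a v"
      using a by (auto simp: mem_principal_left_ideal intro!: bexI[of _ \<one>])
    then obtain h where h: "h \<in> carrier G" "a v = h \<otimes> a n"
      using subsetD[OF le] unfolding mem_principal_left_ideal by blast
    then have "h \<in> Units G"
      using length_function_less_left[OF l, of "a n" h] v[of n] a by fastforce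
    then have "a n = inv h \<otimes> a v" using h a by (simp flip: m_assoc)
    then show "carrier G #> a n \<subseteq> carrier G #> a v"
      using a \<open>h \<in> Units G\<close> by (auto simp: mem_principal_left_ideal)
        (metis Units_inv_closed m_assoc m_closed)
  qed
  then show "\<exists>v. \<forall>n\<ge>v. carrier G #> a n = carrier G #> a v" by blast
qed

lemma length_function_imp_accp:
  assumes "length_function G l"
  shows "accp G"
  using assms length_function_imp_accp_left length_function_imp_accp_right
  by (auto simp: accp_def)

text \<open>Each atom multiplied on the left raises \<open>l\<close> by at least 1, starting from a
  value at least 0 at the empty product. Membership in the carrier is proved alongside because the
  induction step needs it.\<close>

lemma length_atoms_le:
  assumes l: "length_function G l" and "set as \<subseteq> atoms G"
  shows "foldr (\<otimes>) as \<one> \<in> carrier G \<and> length as \<le> l (foldr (\<otimes>) as \<one>)"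
  using assms(2)
proof (induction as)
  case (Cons a as)
  then have "a \<in> carrier G - Units G" by (simp add: atoms_def)
  with Cons length_function_less_left[OF l, of "foldr (\<otimes>) as \<one>" a] show ?case by auto
qed simp

lemma length_set_le:
  assumes "length_function G l" "k \<in> length_set G x"
  shows "k \<le> l x"
  using assms length_atoms_le[OF assms(1)]
  by (auto simp: length_set_def split: if_splits)

lemma length_function_imp_BF_monoid:
  assumes "length_function G l"
  shows "BF_monoid G"
proof -
  have "finite (length_set G x)" for x
    using length_set_le[OF assms] by (meson finite_nat_set_iff_bounded_le)
  moreover have "atomic G"
    using accp_imp_atomic length_function_imp_unit_cancellative length_function_imp_accp assms
    by blast
  ultimately show ?thesis by (simp add: BF_monoid_def atomic_def)
qed

end

theorem theorem2p28:
  fixes H :: "('a, 'b) monoid_scheme" and M :: "'a set"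
  assumes "monoid H"
    and "submonoid M H"
    and "Units (H\<lparr>carrier := M\<rparr>) = M \<inter> Units H"
  shows
    "(unit_cancellative H \<and> accp H \<longrightarrow> atomic H) \<and>
     (unit_cancellative H \<longrightarrow> unit_cancellative (H\<lparr>carrier := M\<rparr>)) \<and>
     ((\<exists>l. length_function H l) \<longrightarrow> unit_cancellative H \<and> accp H) \<and>
     (\<forall>l. length_function H l \<longrightarrow>
        BF_monoid (H\<lparr>carrier := M\<rparr>) \<and>
        (\<forall>x\<in>M. (SUP k\<in>length_set (H\<lparr>carrier := M\<rparr>) x. enat k) \<le> enat (l x)))"
proof (intro conjI impI allI ballI)
  interpret H: monoid H by fact
  show "atomic H" if "unit_cancellative H \<and> accp H"
    using that H.accp_imp_atomic by blast
  show "unit_cancellative (H\<lparr>carrier := M\<rparr>)" if "unit_cancellative H"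
    using that assms(2,3) by (rule unit_cancellative_submonoid)
  show "unit_cancellative H" if "\<exists>l. length_function H l"
    using that H.length_function_imp_unit_cancellative by blast
  show "accp H" if "\<exists>l. length_function H l"
    using that H.length_function_imp_accp by blast
next
  \<comment> \<open>The restriction of \<open>l\<close> is a length function on \<open>M\<close>, so
    the results on a single monoid apply to \<open>M\<close> itself.\<close>
  interpret M: monoid "H\<lparr>carrier := M\<rparr>"
    using assms(1,2) by (intro submonoid.submonoid_is_monoid)
  fix l assume "length_function H l"
  then have l: "length_function (H\<lparr>carrier := M\<rparr>) l"
    using assms(2,3) by (rule length_function_submonoid)
  show "BF_monoid (H\<lparr>carrier := M\<rparr>)"
    using l by (rule M.length_function_imp_BF_monoid)
  \<comment> \<open>An empty \<open>length_set\<close>, possible for units other than the identity,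
    causes no trouble: its supremum in \<open>enat\<close> is 0.\<close>
  show "(SUP k\<in>length_set (H\<lparr>carrier := M\<rparr>) x. enat k) \<le> enat (l x)" for x
    using M.length_set_le[OF l] by (auto intro: SUP_least)
qed

end
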